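(* Let $x \geq 1$ be a real number and $p \geq 1$ be an integer. For any collection of vectors $\mathbf{x}_1,\mathbf{y}_1,\ldots,\mathbf{x}_p,\mathbf{y}_p \in \mathbb{R}^n$, we have \[ \| \mathbf{x}_1 \odot \cdots \odot \mathbf{x}_p\|^x\,\| \mathbf{y}_1 \odot \cdots \odot \mathbf{y}_p\|^x - |\langle \mathbf{x}_1 \odot \cdots \odot \mathbf{x}_p,\ \mathbf{y}_1 \odot \cdots \odot \mathbf{y}_p\rangle|^x \leq \prod_{j=1}^p \|\mathbf{x}_j\|^x\|\mathbf{y}_j\|^x - \prod_{j=1}^p |\langle \mathbf{x}_j,\mathbf{y}_j\rangle|^x. \]
   Context: $\odot$ denotes the Hadamard (entrywise) product of vectors in $\mathbb{R}^n$. $\langle\cdot,\cdot\rangle$ and $\|\cdot\|$ are the usual dot product and Euclidean norm on $\mathbb{R}^n$. The exponent $x$ is a real number, unrelated to the vectors $\mathbf{x}_j$. *)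

theory Defs
  imports "HOL-Analysis.Analysis"
begin

end

theory Submission
  imports Defs
begin

text \<open>
  Two reductions bring the inequality down to the case of two factors with exponent one.

  First, write \<open>a\<close>, \<open>b\<close> for the product of norms and the absolute inner product of the Hadamard
  products, and \<open>A\<close>, \<open>B\<close> for the two products over \<open>j\<close>, all with exponent one.  Both \<open>a \<le> A\<close> and \<open>a - b \<le> A - B\<close>
  hold.  If \<open>b < B\<close>, the interval \<open>[B, A]\<close> arises from \<open>[b, a]\<close> by a shift to the right and a
  lengthening, so the increment of the convex increasing function \<open>t \<mapsto> t powr x\<close> over it is at
  least as large; if \<open>B \<le> b\<close>, monotonicity suffices (\<open>powr_diff_mono\<close>).

  Secondly, both relations propagate when one more factor is appended, given the case of two
  factors (\<open>diff_mult_mono\<close>).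

  For two factors, the entrywise product \<open>u * v\<close> is the diagonal of the matrix \<open>u \<otimes> v\<close>,
  that is, an orthogonal projection of it, and norms and inner products of rank-one matrices are multiplicative.  So the
  claim is that the Cauchy--Schwarz deficit \<open>\<parallel>f\<parallel> \<parallel>g\<parallel> - \<bar>\<langle>f, g\<rangle>\<bar>\<close> does not increase under an
  orthogonal projection (\<open>cauchy_schwarz_deficit_projection\<close>).
\<close>

section \<open>Increments of powers\<close>

text \<open>
  Convexity on the open half-line extends to the end point because \<open>t powr x \<le> t\<close> for
  \<open>0 < t < 1\<close>.
\<close>
lemma powr_convex_on_atLeast_0:
  fixes x :: real
  assumes "1 \<le> x"
  shows "convex_on {0..} (\<lambda>t. t powr x)"
proof (rule convex_on_linorderI)
  fix t u v :: real
  assume t: "0 < t" "t < 1" and uv: "u \<in> {0..}" "v \<in> {0..}" "u < v"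
  show "((1 - t) *\<^sub>R u + t *\<^sub>R v) powr x \<le> (1 - t) * u powr x + t * v powr x"
  proof (cases "u = 0")
    case True
    have "t powr x \<le> t"
      using powr_mono'[of 1 x t] t assms by simp
    then have "t powr x * v powr x \<le> t * v powr x"
      by (rule mult_right_mono) simp
    then show ?thesis
      using True t uv by (simp add: powr_mult)
  next
    case False
    then show ?thesis
      using convex_onD[OF powr_convex[OF assms], of t u v] t uv by simp
  qed
qed simp

text \<open>
  For \<open>b < B\<close> both \<open>a\<close> and \<open>B\<close> lie between \<open>b\<close> and \<open>B + (a - b)\<close> and have the same sum as
  these end points, so convexity compares the two sums of powers.
\<close>
lemma powr_diff_mono:
  fixes a b A B x :: real
  assumes "1 \<le> x" "0 \<le> b" "b \<le> a" "0 \<le> B" "a \<le> A" and diff: "a - b \<le> A - B"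
  shows "a powr x - b powr x \<le> A powr x - B powr x"
proof (cases "B \<le> b")
  case True
  then have "a powr x \<le> A powr x" "B powr x \<le> b powr x"
    using assms by (auto intro!: powr_mono2)
  then show ?thesis by linarith
next
  case False
  define C where "C = B + (a - b)"
  have le: "C powr x \<le> A powr x"
    using assms by (intro powr_mono2) (auto simp: C_def)
  have conv: "convex_on {0..} (\<lambda>t::real. t powr x)"
    using assms(1) by (rule powr_convex_on_atLeast_0)
  have pos: "C - b > 0" using False assms by (simp add: C_def)
  define t where "t = (a - b) / (C - b)"
  have t: "0 \<le> t" "t \<le> 1"
    using False assms pos by (auto simp: t_def C_def field_simps)
  have tC: "t * (C - b) = a - b"
    using pos by (simp add: t_def)
  have a: "a = (1 - t) * b + t * C" and B: "B = (1 - (1 - t)) * b + (1 - t) * C"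
    using tC by (auto simp: C_def algebra_simps)
  have "a powr x \<le> (1 - t) * b powr x + t * C powr x"
    using convex_onD[OF conv, of t b C] t pos assms a by simp
  moreover have "B powr x \<le> (1 - (1 - t)) * b powr x + (1 - t) * C powr x"
    using convex_onD[OF conv, of "1 - t" b C] t pos assms B by simp
  ultimately have "a powr x + B powr x \<le> b powr x + C powr x"
    by (simp add: algebra_simps)
  then show ?thesis using le by linarith
qed

lemma diff_mult_mono:
  fixes a b A B c d :: real
  assumes "a \<le> A" "a - b \<le> A - B" "0 \<le> d" "d \<le> c"
  shows "a * c - b * d \<le> A * c - B * d"
proof -
  have "(B - b) * d \<le> (A - a) * d"
    using assms by (intro mult_right_mono) auto
  also have "\<dots> \<le> (A - a) * c"
    using assms by (intro mult_left_mono) auto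
  finally show ?thesis by (simp add: algebra_simps)
qed

section \<open>The Cauchy--Schwarz deficit and orthogonal projections\<close>

text \<open>
  The inner product splits as \<open>\<langle>f, g\<rangle> + \<langle>f', g'\<rangle>\<close>, whose second term is at most \<open>\<parallel>f'\<parallel> \<parallel>g'\<parallel>\<close>.
  It remains to apply Cauchy--Schwarz in the plane to \<open>(\<parallel>f\<parallel>, \<parallel>f'\<parallel>)\<close> and \<open>(\<parallel>g\<parallel>, \<parallel>g'\<parallel>)\<close>, whose
  lengths are the norms of the two sums.
\<close>
lemma cauchy_schwarz_deficit_projection:
  fixes f f' g g' :: "'a :: real_inner"
  assumes "f \<bullet> f' = 0" "g \<bullet> g' = 0" "f \<bullet> g' = 0" "f' \<bullet> g = 0"
  shows "norm f * norm g - \<bar>f \<bullet> g\<bar> \<le> norm (f + f') * norm (g + g') - \<bar>(f + f') \<bullet> (g + g')\<bar>"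
proof -
  have plane: "norm (h + h') = norm (norm h, norm h')" if "h \<bullet> h' = 0" for h h' :: 'a
    using that by (simp add: norm_eq_sqrt_inner[of "h + h'"] norm_Pair inner_add_left inner_add_right
        inner_commute[of h' h] power2_norm_eq_inner)
  have "norm f * norm g + norm f' * norm g' = (norm f, norm f') \<bullet> (norm g, norm g')"
    by simp
  also have "\<dots> \<le> norm (norm f, norm f') * norm (norm g, norm g')"
    by (rule norm_cauchy_schwarz)
  also have "\<dots> = norm (f + f') * norm (g + g')"
    using assms by (simp add: plane)
  finally have "norm f * norm g + norm f' * norm g' \<le> norm (f + f') * norm (g + g')" .
  moreover have "\<bar>(f + f') \<bullet> (g + g')\<bar> \<le> \<bar>f \<bullet> g\<bar> + norm f' * norm g'"
    using assms Cauchy_Schwarz_ineq2[of f' g'] by (simp add: inner_add_left inner_add_right)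
  ultimately show ?thesis by linarith
qed

section \<open>Hadamard products as diagonals of rank-one matrices\<close>

text \<open>
  Matrices are indexed by pairs, so that the inner product of the type is the Frobenius one.
\<close>
definition tensor :: "real ^ 'n \<Rightarrow> real ^ 'n \<Rightarrow> real ^ ('n \<times> 'n)"
  where "tensor u v = (\<chi> k. u $ fst k * v $ snd k)"

definition diagonal_matrix :: "real ^ 'n \<Rightarrow> real ^ ('n \<times> 'n)"
  where "diagonal_matrix w = (\<chi> k. if fst k = snd k then w $ fst k else 0)"

lemma sum_UNIV_pair:
  "(\<Sum>k\<in>UNIV. h k) = (\<Sum>i\<in>UNIV. \<Sum>j\<in>UNIV. h (i, j))"
  for h :: "'n::finite \<times> 'n \<Rightarrow> real"
  by (simp add: sum.cartesian_product)

lemma inner_tensor: "tensor u v \<bullet> tensor u' v' = (u \<bullet> u') * (v \<bullet> v')"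
  by (simp add: tensor_def inner_vec_def sum_UNIV_pair sum_product mult_ac)

lemma norm_tensor: "norm (tensor u v) = norm u * norm v"
  by (simp add: norm_eq_sqrt_inner inner_tensor real_sqrt_mult)

lemma inner_diagonal_matrix_tensor: "diagonal_matrix w \<bullet> tensor u v = w \<bullet> (u * v)"
  by (simp add: tensor_def diagonal_matrix_def inner_vec_def sum_UNIV_pair if_distrib
      if_distribR mult_ac cong: if_cong)

lemma inner_diagonal_matrix: "diagonal_matrix w \<bullet> diagonal_matrix z = w \<bullet> z"
  by (simp add: diagonal_matrix_def inner_vec_def sum_UNIV_pair if_distrib if_distribR
      cong: if_cong)

lemma norm_diagonal_matrix: "norm (diagonal_matrix w) = norm w"
  by (simp add: norm_eq_sqrt_inner inner_diagonal_matrix)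

text \<open>
  Subtracting from a rank-one matrix its diagonal part leaves something orthogonal to all diagonal
  matrices, so the diagonal part is an orthogonal projection.
\<close>
lemma cauchy_schwarz_deficit_hadamard:
  fixes u u' v v' :: "real ^ 'n"
  shows "norm (u * v) * norm (u' * v') - \<bar>(u * v) \<bullet> (u' * v')\<bar>
           \<le> (norm u * norm u') * (norm v * norm v') - \<bar>u \<bullet> u'\<bar> * \<bar>v \<bullet> v'\<bar>"
proof -
  define r where "r = tensor u v - diagonal_matrix (u * v)"
  define r' where "r' = tensor u' v' - diagonal_matrix (u' * v')"
  have orth: "diagonal_matrix w \<bullet> r = 0" "diagonal_matrix w \<bullet> r' = 0" for w
    by (simp_all add: r_def r'_def inner_diff_right inner_diagonal_matrix_tensor
        inner_diagonal_matrix)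
  have "norm (diagonal_matrix (u * v)) * norm (diagonal_matrix (u' * v'))
          - \<bar>diagonal_matrix (u * v) \<bullet> diagonal_matrix (u' * v')\<bar>
        \<le> norm (diagonal_matrix (u * v) + r) * norm (diagonal_matrix (u' * v') + r')
          - \<bar>(diagonal_matrix (u * v) + r) \<bullet> (diagonal_matrix (u' * v') + r')\<bar>"
    by (rule cauchy_schwarz_deficit_projection)
      (simp_all add: orth inner_commute[of r])
  then show ?thesis
    by (simp add: r_def r'_def norm_diagonal_matrix inner_diagonal_matrix norm_tensor inner_tensor
        abs_mult mult_ac)
qed

text \<open>
  A projection does not increase norms: Cauchy--Schwarz for the rank-one matrix and its own
  diagonal part.
\<close>
lemma norm_hadamard_le:
  fixes u v :: "real ^ 'n"
  shows "norm (u * v) \<le> norm u * norm v"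
proof -
  have "norm (u * v) * norm (u * v) = diagonal_matrix (u * v) \<bullet> tensor u v"
    by (simp add: inner_diagonal_matrix_tensor flip: power2_norm_eq_inner power2_eq_square)
  also have "\<dots> \<le> norm (u * v) * (norm u * norm v)"
    using norm_cauchy_schwarz[of "diagonal_matrix (u * v)" "tensor u v"]
    by (simp add: norm_diagonal_matrix norm_tensor)
  finally show ?thesis
    by (cases "u * v = 0") (auto simp: mult_le_cancel_left_pos)
qed

section \<open>Several factors\<close>

text \<open>
  Starting the induction at one factor is essential: the unit vector of the entrywise product has
  norm \<open>sqrt n\<close>, so for the empty product the estimate of the norms fails as soon as \<open>n > 1\<close>.
\<close>
lemma norm_hadamard_prod_le:
  fixes X :: "nat \<Rightarrow> real ^ 'n"
  assumes "1 \<le> p"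
  shows "norm (\<Prod>j=1..p. X j) \<le> (\<Prod>j=1..p. norm (X j))"
  using assms
proof (induction p rule: nat_induct_at_least)
  case (Suc p)
  have "norm (\<Prod>j=1..Suc p. X j) \<le> norm (\<Prod>j=1..p. X j) * norm (X (Suc p))"
    by (simp add: norm_hadamard_le)
  also have "\<dots> \<le> (\<Prod>j=1..p. norm (X j)) * norm (X (Suc p))"
    by (intro mult_right_mono Suc.IH) simp
  finally show ?case by simp
qed simp

lemma norms_hadamard_prod_le:
  fixes X Y :: "nat \<Rightarrow> real ^ 'n"
  assumes "1 \<le> p"
  shows "norm (\<Prod>j=1..p. X j) * norm (\<Prod>j=1..p. Y j) \<le> (\<Prod>j=1..p. norm (X j) * norm (Y j))"
  using norm_hadamard_prod_le[OF assms, of X] norm_hadamard_prod_le[OF assms, of Y]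
  by (simp add: prod.distrib mult_mono prod_nonneg)

lemma cauchy_schwarz_deficit_hadamard_prod:
  fixes X Y :: "nat \<Rightarrow> real ^ 'n"
  assumes "1 \<le> p"
  shows "norm (\<Prod>j=1..p. X j) * norm (\<Prod>j=1..p. Y j) - \<bar>(\<Prod>j=1..p. X j) \<bullet> (\<Prod>j=1..p. Y j)\<bar>
           \<le> (\<Prod>j=1..p. norm (X j) * norm (Y j)) - (\<Prod>j=1..p. \<bar>X j \<bullet> Y j\<bar>)"
  using assms
proof (induction p rule: nat_induct_at_least)
  case (Suc p)
  let ?P = "\<Prod>j=1..p. X j" and ?Q = "\<Prod>j=1..p. Y j" and ?u = "X (Suc p)" and ?v = "Y (Suc p)"
  have "norm (?P * ?u) * norm (?Q * ?v) - \<bar>(?P * ?u) \<bullet> (?Q * ?v)\<bar>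
          \<le> (norm ?P * norm ?Q) * (norm ?u * norm ?v) - \<bar>?P \<bullet> ?Q\<bar> * \<bar>?u \<bullet> ?v\<bar>"
    by (rule cauchy_schwarz_deficit_hadamard)
  also have "\<dots> \<le> (\<Prod>j=1..p. norm (X j) * norm (Y j)) * (norm ?u * norm ?v)
                    - (\<Prod>j=1..p. \<bar>X j \<bullet> Y j\<bar>) * \<bar>?u \<bullet> ?v\<bar>"
    using Suc.hyps
    by (intro diff_mult_mono norms_hadamard_prod_le Suc.IH Cauchy_Schwarz_ineq2) simp_all
  finally show ?case by simp
qed simp

theorem corollary3p3:
  fixes x :: real and p :: nat and X Y :: "nat \<Rightarrow> real ^ 'n"
  assumes "x \<ge> 1" and "p \<ge> 1"
  shows "norm (\<Prod>j=1..p. X j) powr x * norm (\<Prod>j=1..p. Y j) powr x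
           - \<bar>(\<Prod>j=1..p. X j) \<bullet> (\<Prod>j=1..p. Y j)\<bar> powr x
         \<le> (\<Prod>j=1..p. norm (X j) powr x * norm (Y j) powr x)
           - (\<Prod>j=1..p. \<bar>X j \<bullet> Y j\<bar> powr x)"
proof -
  have "(norm (\<Prod>j=1..p. X j) * norm (\<Prod>j=1..p. Y j)) powr x
           - \<bar>(\<Prod>j=1..p. X j) \<bullet> (\<Prod>j=1..p. Y j)\<bar> powr x
         \<le> (\<Prod>j=1..p. norm (X j) * norm (Y j)) powr x - (\<Prod>j=1..p. \<bar>X j \<bullet> Y j\<bar>) powr x"
    using assms
    by (intro powr_diff_mono norms_hadamard_prod_le cauchy_schwarz_deficit_hadamard_prod
        Cauchy_Schwarz_ineq2) (auto intro: prod_nonneg)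
  then show ?thesis
    by (simp add: powr_mult prod_powr_distrib prod_nonneg)
qed

end
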